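(* The function $I_M:\mathcal{F}_N\times 2^N\to\mathbb{R}$ is a cardinal-probabilistic interaction index, given by $$ I_M(v,S)=\sum_{T\subseteq N\setminus S}p_t^s(n)\,\Delta_S v(T)\qquad(v\in\mathcal{F}_N,\ S\subseteq N), $$ where $p_t^s(n):=\dfrac{B(n-t+1,s+t+1)}{B(s+1,s+1)}$.
   Context: Let $N=\{1,\ldots,n\}$, $n\geqslant 1$, and let $\mathcal{F}_N$ be the family of all set functions $v:2^N\to\mathbb{R}$. Cardinalities of subsets $S,T,R$ are denoted by $s,t,r$. The M\"obius transform of $v$ is $a(S)=\sum_{T\subseteq S}(-1)^{s-t}v(T)$. For disjoint $S,T\subseteq N$, the $S$-derivative of $v$ at $T$ is $\Delta_S v(T):=\sum_{R\subseteq S}(-1)^{s-r}v(R\cup T)$. The beta function is $B(a,b):=\int_0^1u^{a-1}(1-u)^{b-1}\,du$ for $a,b>0$. The mapping $I_M:\mathcal{F}_N\times 2^N\to\mathbb{R}$ is defined by $I_M(v,S)=\sum_{T\supseteq S}q_t^s\,a(T)$ (sum over $T\subseteq N$), where $q_t^s:=\binom{2s+1}{s+1}\big/\binom{s+t+1}{s+1}=\frac{B(t+1,s+1)}{B(s+1,s+1)}$ for $t\geqslant s\geqslant 0$. A cardinal-probabilistic interaction index on $N$ is a mapping $I_p:\mathcal{F}_N\times 2^N\to\mathbb{R}$ such that, for any $S\subseteq N$, there is a family of nonnegative real numbers $\{p_t^s(n)\}_{t=0,\ldots,n-s}$ (depending on $S$ only through $s$) satisfying $\sum_{t=0}^{n-s}\binom{n-s}{t}p_t^s(n)=1$,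 such that $I_p(v,S)=\sum_{T\subseteq N\setminus S}p_t^s(n)\,\Delta_S v(T)$ for all $v\in\mathcal{F}_N$. *)

theory Defs
  imports "HOL-Analysis.Analysis"
begin

text \<open>
  The family of set functions on \<open>N = {1..n}\<close>.  A real-valued function on the power set of \<open>N\<close>
  is encoded as an extensional function, so that its values off \<open>Pow N\<close> carry no information.
\<close>

definition set_functions :: "nat \<Rightarrow> (nat set \<Rightarrow> real) set" where
  "set_functions n = Pow {1..n} \<rightarrow>\<^sub>E UNIV"

definition moebius :: "(nat set \<Rightarrow> real) \<Rightarrow> nat set \<Rightarrow> real" where
  "moebius v S = (\<Sum>T\<in>Pow S. (-1) ^ (card S - card T) * v T)"

text \<open>\<open>set_derivative S v T\<close> is \<open>\<Delta>\<^sub>S v(T)\<close>; it is only used for disjoint \<open>S\<close> and \<open>T\<close>.\<close>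

definition set_derivative :: "nat set \<Rightarrow> (nat set \<Rightarrow> real) \<Rightarrow> nat set \<Rightarrow> real" where
  "set_derivative S v T = (\<Sum>R\<in>Pow S. (-1) ^ (card S - card R) * v (R \<union> T))"

text \<open>In \<open>I_M_coeff s t\<close> and \<open>I_M_weight n s t\<close> the superscript \<open>s\<close> comes before the subscript \<open>t\<close>.\<close>

definition I_M_coeff :: "nat \<Rightarrow> nat \<Rightarrow> real" where
  "I_M_coeff s t = real ((2 * s + 1) choose (s + 1)) / real ((s + t + 1) choose (s + 1))"

definition I_M :: "nat \<Rightarrow> (nat set \<Rightarrow> real) \<Rightarrow> nat set \<Rightarrow> real" where
  "I_M n v S = (\<Sum>T | S \<subseteq> T \<and> T \<subseteq> {1..n}. I_M_coeff (card S) (card T) * moebius v T)"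

text \<open>
  The conditions on the families \<open>p\<^sub>t\<^sup>s(n) = p s t\<close>.  Indexing by \<open>s\<close> rather than by the coalition
  expresses that the family depends on \<open>S\<close> only through its cardinality; every \<open>s \<le> n\<close>
  is the cardinality of some \<open>S \<subseteq> {1..n}\<close>.
\<close>

definition cardinal_probabilistic_weights :: "nat \<Rightarrow> (nat \<Rightarrow> nat \<Rightarrow> real) \<Rightarrow> bool" where
  "cardinal_probabilistic_weights n p \<longleftrightarrow>
     (\<forall>s\<le>n. (\<forall>t\<le>n - s. 0 \<le> p s t) \<and> (\<Sum>t=0..n - s. real ((n - s) choose t) * p s t) = 1)"

definition cardinal_probabilistic_index ::
  "nat \<Rightarrow> ((nat set \<Rightarrow> real) \<Rightarrow> nat set \<Rightarrow> real) \<Rightarrow> bool" where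
  "cardinal_probabilistic_index n I \<longleftrightarrow>
     (\<exists>p. cardinal_probabilistic_weights n p \<and>
          (\<forall>v\<in>set_functions n. \<forall>S\<in>Pow {1..n}.
             I v S = (\<Sum>T\<in>Pow ({1..n} - S). p (card S) (card T) * set_derivative S v T)))"

text \<open>
  The library constant \<open>Beta\<close> is defined through \<open>Gamma\<close>; for positive real arguments it is
  Euler's integral by \<open>has_integral_Beta_real\<close>.  The subtraction \<open>n - t\<close> is taken in the reals;
  the arguments are positive for \<open>t \<le> n\<close>.
\<close>

definition I_M_weight :: "nat \<Rightarrow> nat \<Rightarrow> nat \<Rightarrow> real" where
  "I_M_weight n s t =
     Beta (real n - real t + 1) (real s + real t + 1) / Beta (real s + 1) (real s + 1)"

end

theory Submission
  imports Defs
begin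

text \<open>
  The binomial quotient defining \<open>I_M_coeff s t\<close> equals \<open>B(t+1,s+1) / B(s+1,s+1)\<close>, so the
  statement compares two sums with Beta-function coefficients.  Two identities relate them.

  On the side of set functions, the derivative of \<open>v\<close> in the direction \<open>S\<close> at \<open>T\<close> collects the
  Moebius coefficients of the sets between \<open>S\<close> and \<open>S \<union> T\<close>
  (\<open>set_derivative_eq_sum_moebius\<close>).  Hence in
  \<open>\<Sum>T\<subseteq>N-S. p\<^sub>t \<Delta>\<^sub>S v(T)\<close> the coefficient of \<open>moebius v (S \<union> R)\<close> is the sum of \<open>p\<^sub>t\<close> over all
  \<open>T\<close> with \<open>R \<subseteq> T \<subseteq> N - S\<close>.

  On the side of the weights, \<open>B(a,b) = B(a+1,b) + B(a,b+1)\<close> says that the mass \<open>B(a,b)\<close> is split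
  according to whether a further element belongs to \<open>T\<close> or not.  Splitting once for every
  element of \<open>X\<close> gives \<open>B(a,b)\<close> as a sum over the subsets of \<open>X\<close> (\<open>sum_Beta_Pow\<close>); this is the
  binomial theorem \<open>(u + (1-u))\<^sup>m = 1\<close> under Euler's integral.  With \<open>X = N - S - R\<close> it evaluates
  the coefficient above to the one in \<open>I_M\<close> (\<open>sum_I_M_weight_interval\<close>).  The case \<open>R = {}\<close>, where
  the coefficient is \<open>1\<close>, is the normalisation of the weights.
\<close>

lemma sum_Pow_insert:
  fixes f :: "'a set \<Rightarrow> 'b::comm_monoid_add"
  assumes "finite A" "x \<notin> A"
  shows "(\<Sum>T\<in>Pow (insert x A). f T) = (\<Sum>T\<in>Pow A. f T) + (\<Sum>T\<in>Pow A. f (insert x T))"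
proof -
  have "inj_on (insert x) (Pow A)"
    using assms by (auto simp: inj_on_def)
  moreover have "Pow A \<inter> insert x ` Pow A = {}"
    using assms by auto
  ultimately show ?thesis
    using assms by (simp add: Pow_insert sum.union_disjoint sum.reindex o_def)
qed

lemma sum_interval_eq_sum_Pow:
  fixes f :: "'a set \<Rightarrow> 'b::comm_monoid_add"
  assumes "R \<subseteq> X"
  shows "(\<Sum>T | R \<subseteq> T \<and> T \<subseteq> X. f T) = (\<Sum>Q\<in>Pow (X - R). f (R \<union> Q))"
  by (rule sum.reindex_bij_witness[where i = "\<lambda>Q. R \<union> Q" and j = "\<lambda>T. T - R"])
     (use assms in \<open>auto simp: Un_absorb1\<close>)

lemma sum_Pow_card:
  fixes f :: "nat \<Rightarrow> real"
  assumes "finite X"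
  shows "(\<Sum>T\<in>Pow X. f (card T)) = (\<Sum>t=0..card X. real (card X choose t) * f t)"
proof -
  have "(\<Sum>T\<in>Pow X. f (card T)) = (\<Sum>t=0..card X. \<Sum>T | T \<in> Pow X \<and> card T = t. f (card T))"
    using assms by (subst sum.group) (auto intro: card_mono)
  also have "\<dots> = (\<Sum>t=0..card X. real (card X choose t) * f t)"
    using n_subsets[OF assms] by (intro sum.cong) auto
  finally show ?thesis .
qed

lemma set_derivative_insert:
  assumes "finite S" "x \<notin> S"
  shows "set_derivative (insert x S) v T = set_derivative S v (insert x T) - set_derivative S v T"
proof -
  have c: "card R \<le> card S" "finite R" "x \<notin> R" if "R \<in> Pow S" for R
    using that assms by (auto intro: card_mono finite_subset)
  have "set_derivative (insert x S) v T =
      (\<Sum>R\<in>Pow S. (-1) ^ (Suc (card S) - card R) * v (R \<union> T)) +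
      (\<Sum>R\<in>Pow S. (-1) ^ (Suc (card S) - card (insert x R)) * v (insert x R \<union> T))"
    using assms by (simp add: set_derivative_def sum_Pow_insert)
  also have "(\<Sum>R\<in>Pow S. (-1) ^ (Suc (card S) - card R) * v (R \<union> T)) = - set_derivative S v T"
    unfolding set_derivative_def sum_negf[symmetric]
    by (intro sum.cong) (auto simp: Suc_diff_le c)
  also have "(\<Sum>R\<in>Pow S. (-1) ^ (Suc (card S) - card (insert x R)) * v (insert x R \<union> T)) =
      set_derivative S v (insert x T)"
    unfolding set_derivative_def by (intro sum.cong) (auto simp: c)
  finally show ?thesis by simp
qed

text \<open>
  Moebius inversion, localised above \<open>S\<close>: the case \<open>S = {}\<close> recovers \<open>v\<close> from its Moebius
  transform, and the case \<open>T = {}\<close> identifies \<open>moebius v S\<close> with the derivative at the empty set.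
  Moving an element from \<open>T\<close> to \<open>S\<close> changes both sides by the same rule, which gives the
  induction over \<open>T\<close> with \<open>S\<close> arbitrary.
\<close>

lemma set_derivative_eq_sum_moebius:
  assumes "finite T" "finite S" "S \<inter> T = {}"
  shows "set_derivative S v T = (\<Sum>R\<in>Pow T. moebius v (S \<union> R))"
  using assms
proof (induction T arbitrary: S rule: finite_induct)
  case empty
  then show ?case by (simp add: set_derivative_def moebius_def)
next
  case (insert x T)
  have "set_derivative S v (insert x T) = set_derivative S v T + set_derivative (insert x S) v T"
    using insert.prems by (simp add: set_derivative_insert)
  also have "\<dots> = (\<Sum>R\<in>Pow T. moebius v (S \<union> R)) + (\<Sum>R\<in>Pow T. moebius v (insert x S \<union> R))"
    using insert.prems insert.hyps by (simp add: insert.IH)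
  also have "\<dots> = (\<Sum>R\<in>Pow (insert x T). moebius v (S \<union> R))"
    using insert.hyps by (simp add: sum_Pow_insert)
  finally show ?case .
qed

text \<open>
  The binomial theorem \<open>\<Sum>T\<subseteq>X. u\<^sup>t (1-u)\<^sup>m\<^sup>-\<^sup>t = 1\<close>, with \<open>t = card T\<close> and
  \<open>m = card X\<close>, integrated against \<open>u\<^sup>a\<^sup>-\<^sup>1 (1-u)\<^sup>b\<^sup>-\<^sup>1\<close>.  Indexing by subsets instead of cardinalities
  makes it an iteration of the splitting \<open>B(a,b) = B(a+1,b) + B(a,b+1)\<close>, free of binomial
  coefficients.
\<close>

lemma sum_Beta_Pow:
  fixes a b :: real
  assumes "finite X" "a > 0" "b > 0"
  shows "(\<Sum>T\<in>Pow X. Beta (a + card T) (b + card X - card T)) = Beta a b"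
  using assms
proof (induction X arbitrary: a b rule: finite_induct)
  case empty
  then show ?case by simp
next
  case (insert x X)
  have c: "finite T" "x \<notin> T" if "T \<in> Pow X" for T
    using that insert.hyps by (auto intro: finite_subset)
  have "(\<Sum>T\<in>Pow (insert x X). Beta (a + card T) (b + card (insert x X) - card T)) =
      (\<Sum>T\<in>Pow X. Beta (a + card T) ((b + 1) + card X - card T)) +
      (\<Sum>T\<in>Pow X. Beta ((a + 1) + card T) (b + card X - card T))"
    unfolding sum_Pow_insert[OF insert.hyps]
    \<comment> \<open>an element outside \<open>T\<close> raises the second argument, an element of \<open>T\<close> the first\<close>
    by (rule arg_cong2[where f = "(+)"]; rule sum.cong[OF refl]; rule arg_cong2[where f = Beta])
       (simp_all add: insert.hyps c)
  also have "\<dots> = Beta a (b + 1) + Beta (a + 1) b"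
    using insert.prems by (simp only: insert.IH)
  also have "\<dots> = Beta a b"
    using insert.prems by (subst Beta_plus1_plus1[symmetric]) (auto elim!: nonpos_Ints_cases)
  finally show ?case .
qed

lemma Beta_Suc_Suc:
  "Beta (real t + 1) (real s + 1) = fact t * fact s / (fact (s + t + 1) :: real)"
proof -
  have "Gamma (real t + 1 + (real s + 1)) = (fact (s + t + 1) :: real)"
    using Gamma_fact[of "s + t + 1", where ?'a = real] by (simp add: algebra_simps)
  then show ?thesis
    using Gamma_fact[of t, where ?'a = real] Gamma_fact[of s, where ?'a = real]
    by (simp add: Beta_def add.commute)
qed

lemma I_M_coeff_eq_Beta:
  "I_M_coeff s t = Beta (real t + 1) (real s + 1) / Beta (real s + 1) (real s + 1)"
proof -
  have "real ((s + k + 1) choose (s + 1)) = fact (s + k + 1) / (fact (s + 1) * fact k)" for k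
    by (subst binomial_fact) auto
  then show ?thesis
    unfolding I_M_coeff_def Beta_Suc_Suc mult_2
    by (simp add: mult.commute del: fact_Suc binomial_Suc_Suc)
qed

lemma Beta_pos:
  fixes a b :: real
  assumes "a > 0" "b > 0"
  shows "Beta a b > 0"
  using assms by (simp add: Beta_def Gamma_real_pos)

text \<open>
  The factor that multiplies the Moebius coefficient at \<open>S \<union> R\<close> when the weighted sum of derivatives is
  expanded, for \<open>X = N - S\<close>.
\<close>

lemma sum_I_M_weight_interval:
  assumes "finite X" "card X + s = n" "R \<subseteq> X"
  shows "(\<Sum>T | R \<subseteq> T \<and> T \<subseteq> X. I_M_weight n s (card T)) = I_M_coeff s (s + card R)"
proof -
  have fin: "finite R" "finite (X - R)"
    using assms by (auto intro: finite_subset)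
  have n: "real n = real s + real (card R) + real (card (X - R))"
    using assms card_Diff_subset[OF fin(1) assms(3)] card_mono[OF assms(1,3)] by linarith
  have card: "card (R \<union> Q) = card R + card Q" if "Q \<in> Pow (X - R)" for Q
    using that fin by (subst card_Un_disjoint) (auto intro: finite_subset)
  have "(\<Sum>T | R \<subseteq> T \<and> T \<subseteq> X. I_M_weight n s (card T)) =
      (\<Sum>Q\<in>Pow (X - R). I_M_weight n s (card (R \<union> Q)))"
    by (rule sum_interval_eq_sum_Pow[OF assms(3)])
  also have "\<dots> = (\<Sum>Q\<in>Pow (X - R).
      Beta (real (s + card R) + 1 + card Q) (real s + 1 + card (X - R) - card Q)) /
      Beta (real s + 1) (real s + 1)"
    unfolding sum_divide_distrib
    by (intro sum.cong refl, subst Beta_commute) (simp add: I_M_weight_def card n algebra_simps)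
  also have "\<dots> = I_M_coeff s (s + card R)"
    by (simp add: sum_Beta_Pow fin I_M_coeff_eq_Beta)
  finally show ?thesis .
qed

lemma cardinal_probabilistic_weights_I_M_weight:
  "cardinal_probabilistic_weights n (I_M_weight n)"
  unfolding cardinal_probabilistic_weights_def
proof (intro allI impI conjI)
  fix s t assume "s \<le> n" "t \<le> n - s"
  then show "0 \<le> I_M_weight n s t"
    unfolding I_M_weight_def by (intro divide_nonneg_nonneg less_imp_le[OF Beta_pos]) auto
next
  fix s assume "s \<le> n"
  then have "(\<Sum>T | {} \<subseteq> T \<and> T \<subseteq> {1..n - s}. I_M_weight n s (card T)) =
      I_M_coeff s (s + card ({} :: nat set))"
    by (intro sum_I_M_weight_interval) auto
  also have "\<dots> = 1"
    using Beta_pos[of "real s + 1" "real s + 1"] by (simp add: I_M_coeff_eq_Beta)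
  finally have "(\<Sum>T\<in>Pow {1..n - s}. I_M_weight n s (card T)) = 1"
    by (simp add: Pow_def)
  then show "(\<Sum>t=0..n - s. real ((n - s) choose t) * I_M_weight n s t) = 1"
    by (simp add: sum_Pow_card)
qed

lemma I_M_eq_sum_set_derivative:
  assumes "S \<subseteq> {1..n}"
  shows "I_M n v S =
    (\<Sum>T\<in>Pow ({1..n} - S). I_M_weight n (card S) (card T) * set_derivative S v T)"
proof -
  define X where "X = {1..n} - S"
  define p where "p = (\<lambda>T :: nat set. I_M_weight n (card S) (card T))"
  have fin: "finite S" "finite X"
    using assms by (auto simp: X_def intro: finite_subset)
  have n: "card X + card S = n"
    using assms card_mono[OF _ assms] fin by (simp add: X_def card_Diff_subset)
  have finR: "finite T" "S \<inter> T = {}" if "T \<in> Pow X" for T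
    using that fin by (auto simp: X_def intro: finite_subset)
  have "I_M n v S = (\<Sum>R\<in>Pow X. I_M_coeff (card S) (card (S \<union> R)) * moebius v (S \<union> R))"
    unfolding I_M_def X_def by (rule sum_interval_eq_sum_Pow[OF assms])
  also have "\<dots> = (\<Sum>R\<in>Pow X. (\<Sum>T | T \<in> Pow X \<and> R \<subseteq> T. p T) * moebius v (S \<union> R))"
  proof (intro sum.cong refl)
    fix R assume R: "R \<in> Pow X"
    have "(\<Sum>T | T \<in> Pow X \<and> R \<subseteq> T. p T) = (\<Sum>T | R \<subseteq> T \<and> T \<subseteq> X. p T)"
      by (rule sum.cong) auto
    also have "\<dots> = I_M_coeff (card S) (card S + card R)"
      unfolding p_def using R n fin by (intro sum_I_M_weight_interval) auto
    also have "card S + card R = card (S \<union> R)"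
      using finR[OF R] fin by (simp add: card_Un_disjoint)
    finally show "I_M_coeff (card S) (card (S \<union> R)) * moebius v (S \<union> R) =
        (\<Sum>T | T \<in> Pow X \<and> R \<subseteq> T. p T) * moebius v (S \<union> R)"
      by simp
  qed
  also have "\<dots> = (\<Sum>T\<in>Pow X. \<Sum>R | R \<in> Pow X \<and> R \<subseteq> T. p T * moebius v (S \<union> R))"
    unfolding sum_distrib_right using fin by (intro sum.swap_restrict) auto
  also have "\<dots> = (\<Sum>T\<in>Pow X. p T * set_derivative S v T)"
  proof (intro sum.cong refl)
    fix T assume T: "T \<in> Pow X"
    then have "{R. R \<in> Pow X \<and> R \<subseteq> T} = Pow T"
      by auto
    then show "(\<Sum>R | R \<in> Pow X \<and> R \<subseteq> T. p T * moebius v (S \<union> R)) = p T * set_derivative S v T"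
      using finR[OF T] fin by (simp add: set_derivative_eq_sum_moebius sum_distrib_left)
  qed
  finally show ?thesis
    by (simp add: X_def p_def)
qed

theorem proposition17:
  fixes n :: nat
  assumes "n \<ge> 1"
  shows "cardinal_probabilistic_index n (I_M n) \<and>
    cardinal_probabilistic_weights n (I_M_weight n) \<and>
    (\<forall>v\<in>set_functions n. \<forall>S\<in>Pow {1..n}.
       I_M n v S =
         (\<Sum>T\<in>Pow ({1..n} - S). I_M_weight n (card S) (card T) * set_derivative S v T))"
  unfolding cardinal_probabilistic_index_def
  using cardinal_probabilistic_weights_I_M_weight I_M_eq_sum_set_derivative by blast

end
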